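(* Let $\vartheta\in[0,2]$, $K\in\mathcal{K}_{0,\vartheta}$ and $u\in\mathcal{C}_{\vartheta,K}$ (the class with $m=0$). Let $f$ be bounded and continuous in $B_1$. Then $$Au=f\quad\text{(pointwise) in }B_1$$ is equivalent to $$Au\stackrel{0}{=}f\quad\text{in }B_1.$$
   Context: $B_r(x)$ is the open ball in $\mathbb{R}^n$ of radius $r$ centered at $x$, $B_r:=B_r(0)$, $\Omega^c:=\mathbb{R}^n\setminus\Omega$. All functions and kernels are real-valued and Lebesgue measurable. $\chi_R$ is the characteristic function of $B_R$. For a kernel $K=K(x,y)$ the operator $A$ is $$Au(x)=\lim_{\varepsilon\searrow0}\int_{\mathbb{R}^n\setminus B_\varepsilon(x)}(u(x)-u(y))K(x,y)\,dy.$$ For $\vartheta\in[0,2]$, $\mathcal{C}_\vartheta$ is the set of $u\in L^1_{\rm loc}(\mathbb{R}^n)$ such that $u\in C(B_4)\cap L^\infty(B_4)$ if $\vartheta=0$; $u\in C^\vartheta(B_4)$ if $\vartheta\in(0,1)$; $u\in C^{0,1}(B_4)$ if $\vartheta=1$; $u\in C^{1,\vartheta-1}(B_4)$ if $\vartheta\in(1,2)$; $u\in C^{1,1}(B_4)$ if $\vartheta=2$ (Hölder spaces with finite norm on $B_4$). $\mathcal{K}_{0,\vartheta}$ is the set of kernels $K$ such that: for all $y\in B_3^c$ the map $B_1\ni x\mapsto K(x,y)$ is continuous; $\int_{\mathbb{R}^n}\min\{|x-y|^\vartheta,1\}|K(x,y)|\,dy<+\infty$ for all $x\in B_1$; and,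 only if $\vartheta\in(1,2]$, additionally $K(x,x+z)=K(x,x-z)$ for all $x,z\in B_1$. Given $K\in\mathcal{K}_{0,\vartheta}$, $\mathcal{C}_{\vartheta,K}$ (with $m=0$) is the set of $u\in\mathcal{C}_\vartheta$ such that $\int_{B_3^c}|u(y)|\sup_{x\in B_1}|K(x,y)|\,dy<+\infty$. Definition: for such $K$, $u$ and for $f:B_1\to\mathbb{R}$ bounded and continuous, $Au\stackrel{0}{=}f$ in $B_1$ means that there exist functions $f_R:B_1\to\mathbb{R}$ ($R>3$) such that $A(\chi_Ru)=f_R$ pointwise in $B_1$ and $\lim_{R\to+\infty}f_R(x)=f(x)$ for every $x\in B_1$. (This is the case $m=0$ of the general definition, in which $A(\chi_R u)=f_R+P_R$ with $P_R$ a polynomial of degree at most $m-1$; for $m=0$ one has $P_R=0$.) *)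

theory Defs
  imports "HOL-Analysis.Analysis"
begin

text \<open>
  Kernels are curried functions \<open>K x y\<close> on \<open>real ^ 'n\<close>. Functions that the mathematics considers only on
  \<open>B\<^sub>1\<close> or \<open>B\<^sub>4\<close> are total here, and every condition on them is relativised to that ball.
\<close>

subsection \<open>The operator\<close>

text \<open>
  \<open>has_nonlocal_value K u x l\<close> says that \<open>Au(x)\<close> exists and equals \<open>l\<close>. Integrability is demanded
  explicitly, because the Bochner integral of a non-integrable function is \<open>0\<close> by convention.
\<close>

definition has_nonlocal_value ::
    "(real ^ 'n \<Rightarrow> real ^ 'n \<Rightarrow> real) \<Rightarrow> (real ^ 'n \<Rightarrow> real) \<Rightarrow> real ^ 'n \<Rightarrow> real \<Rightarrow> bool" where
  "has_nonlocal_value K u x l \<longleftrightarrow>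
     (\<forall>\<epsilon>>0. set_integrable lebesgue (- ball x \<epsilon>) (\<lambda>y. (u x - u y) * K x y)) \<and>
     ((\<lambda>\<epsilon>. LINT y:(- ball x \<epsilon>)|lebesgue. (u x - u y) * K x y) \<longlongrightarrow> l) (at_right 0)"

definition nonlocal_eq ::
    "(real ^ 'n \<Rightarrow> real ^ 'n \<Rightarrow> real) \<Rightarrow> (real ^ 'n \<Rightarrow> real) \<Rightarrow> (real ^ 'n \<Rightarrow> real) \<Rightarrow> bool" where
  "nonlocal_eq K u f \<longleftrightarrow> (\<forall>x \<in> ball 0 1. has_nonlocal_value K u x (f x))"

text \<open>The relation \<open>Au = f\<close> in \<open>B\<^sub>1\<close> modulo polynomials of degree at most \<open>m - 1\<close>, for \<open>m = 0\<close>, where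
  the only such polynomial is \<open>0\<close>.\<close>

definition nonlocal_eq0 ::
    "(real ^ 'n \<Rightarrow> real ^ 'n \<Rightarrow> real) \<Rightarrow> (real ^ 'n \<Rightarrow> real) \<Rightarrow> (real ^ 'n \<Rightarrow> real) \<Rightarrow> bool" where
  "nonlocal_eq0 K u f \<longleftrightarrow>
     (\<exists>F :: real \<Rightarrow> real ^ 'n \<Rightarrow> real.
        (\<forall>R>3. nonlocal_eq K (\<lambda>y. indicator (ball 0 R) y * u y) (F R)) \<and>
        (\<forall>x \<in> ball 0 1. ((\<lambda>R. F R x) \<longlongrightarrow> f x) at_top))"

subsection \<open>Function classes\<close>

definition locally_integrable :: "(real ^ 'n \<Rightarrow> real) \<Rightarrow> bool" where
  "locally_integrable u \<longleftrightarrow>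
     u \<in> borel_measurable lebesgue \<and> (\<forall>C. compact C \<longrightarrow> set_integrable lebesgue C u)"

text \<open>Finiteness of the norm of \<open>C\<^bsup>0,\<alpha>\<^esup>(S)\<close>, and likewise of \<open>C\<^bsup>1,\<alpha>\<^esup>(S)\<close> below.\<close>

definition C0_holder_on :: "real \<Rightarrow> (real ^ 'n) set \<Rightarrow> (real ^ 'n \<Rightarrow> 'b::real_normed_vector) \<Rightarrow> bool" where
  "C0_holder_on \<alpha> S g \<longleftrightarrow>
     bounded (g ` S) \<and>
     (\<exists>C. \<forall>x\<in>S. \<forall>y\<in>S. norm (g x - g y) \<le> C * norm (x - y) powr \<alpha>)"

definition C1_holder_on :: "real \<Rightarrow> (real ^ 'n) set \<Rightarrow> (real ^ 'n \<Rightarrow> real) \<Rightarrow> bool" where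
  "C1_holder_on \<alpha> S u \<longleftrightarrow>
     bounded (u ` S) \<and>
     (\<exists>D. (\<forall>x\<in>S. GDERIV u x :> D x) \<and> C0_holder_on \<alpha> S D)"

definition function_class :: "real \<Rightarrow> (real ^ 'n \<Rightarrow> real) set" where
  "function_class \<theta> =
     {u. locally_integrable u \<and>
         (\<theta> = 0 \<longrightarrow> continuous_on (ball 0 4) u \<and> bounded (u ` ball 0 4)) \<and>
         (0 < \<theta> \<and> \<theta> \<le> 1 \<longrightarrow> C0_holder_on \<theta> (ball 0 4) u) \<and>
         (1 < \<theta> \<and> \<theta> \<le> 2 \<longrightarrow> C1_holder_on (\<theta> - 1) (ball 0 4) u)}"

text \<open>
  Joint Lebesgue measurability gives measurability of \<open>K x\<close> only for almost every \<open>x\<close>; the integrals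
  \<open>\<integral> \<dots> K(x,y) dy\<close> are taken for every \<open>x \<in> B\<^sub>1\<close>, so measurability of these sections is required too.
  For \<open>\<theta> = 0\<close> the convention \<open>0 powr 0 = 0\<close> affects the weight only on the null set \<open>{x}\<close>.
\<close>

definition kernel_class :: "real \<Rightarrow> (real ^ 'n \<Rightarrow> real ^ 'n \<Rightarrow> real) set" where
  "kernel_class \<theta> =
     {K. (\<lambda>(x, y). K x y) \<in> borel_measurable lebesgue \<and>
         (\<forall>x \<in> ball 0 1. K x \<in> borel_measurable lebesgue) \<and>
         (\<forall>y \<in> - ball 0 3. continuous_on (ball 0 1) (\<lambda>x. K x y)) \<and>
         (\<forall>x \<in> ball 0 1. integrable lebesgue (\<lambda>y. min (norm (x - y) powr \<theta>) 1 * \<bar>K x y\<bar>)) \<and>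
         (1 < \<theta> \<and> \<theta> \<le> 2 \<longrightarrow>
            (\<forall>x \<in> ball 0 1. \<forall>z \<in> ball 0 1. K x (x + z) = K x (x - z)))}"

text \<open>The supremum is taken in \<open>[0, \<infinity>]\<close>, since it may be infinite for some \<open>y\<close>.\<close>

definition function_kernel_class ::
    "real \<Rightarrow> (real ^ 'n \<Rightarrow> real ^ 'n \<Rightarrow> real) \<Rightarrow> (real ^ 'n \<Rightarrow> real) set" where
  "function_kernel_class \<theta> K =
     {u \<in> function_class \<theta>.
        (\<integral>\<^sup>+ y \<in> - ball 0 3. ennreal \<bar>u y\<bar> * (SUP x \<in> ball 0 1. ennreal \<bar>K x y\<bar>) \<partial>lebesgue) < \<infinity>}"

end

theory Submission
  imports Defs
begin

text \<open>
  For \<open>x \<in> B\<^sub>1\<close> and \<open>R > 3\<close>, replacing \<open>u\<close> by \<open>\<chi>\<^sub>R u\<close> changes the integrand only far away from \<open>x\<close>, so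
  \<open>A(\<chi>\<^sub>R u)(x)\<close> exists iff \<open>Au(x)\<close> does, and the two differ by the absolutely convergent tail
  \<open>\<integral> u(y) K(x,y) dy\<close> over the complement of \<open>B\<^sub>R\<close>. The tail vanishes as \<open>R \<rightarrow> \<infinity>\<close> by dominated convergence.
\<close>

text \<open>For the fixed \<open>x\<close>, the factor \<open>\<bar>K x y\<bar>\<close> is one of
  the terms of the supremum in \<open>function_kernel_class\<close>, so the finite integral there
  dominates this one. Measurability uses the section \<open>K x\<close>, which the kernel class
  controls for every \<open>x\<close> in the unit ball.\<close>

lemma set_integrable_tail:
  fixes K :: "real ^ 'n \<Rightarrow> real ^ 'n \<Rightarrow> real"
  assumes K: "K \<in> kernel_class \<theta>" and u: "u \<in> function_kernel_class \<theta> K"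
    and x: "x \<in> ball 0 1"
  shows "set_integrable lebesgue (- ball 0 3) (\<lambda>y. u y * K x y)"
  unfolding set_integrable_def
proof (rule integrableI_bounded)
  have "u \<in> borel_measurable lebesgue"
    using u by (simp add: function_kernel_class_def function_class_def locally_integrable_def)
  moreover have "K x \<in> borel_measurable lebesgue"
    using K x by (simp add: kernel_class_def)
  ultimately show "(\<lambda>y. indicator (- ball 0 3) y *\<^sub>R (u y * K x y)) \<in> borel_measurable lebesgue"
    by (intro borel_measurable_scaleR borel_measurable_times borel_measurable_indicator) auto
  have "(\<integral>\<^sup>+ y. norm (indicator (- ball 0 3) y *\<^sub>R (u y * K x y)) \<partial>lebesgue)
      \<le> (\<integral>\<^sup>+ y \<in> - ball 0 3. ennreal \<bar>u y\<bar> * (SUP x \<in> ball 0 1. ennreal \<bar>K x y\<bar>) \<partial>lebesgue)"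
    using x by (intro nn_integral_mono)
      (auto simp: indicator_def abs_mult ennreal_mult intro!: mult_left_mono SUP_upper)
  also have "\<dots> < \<infinity>"
    using u by (simp add: function_kernel_class_def)
  finally show "(\<integral>\<^sup>+ y. norm (indicator (- ball 0 3) y *\<^sub>R (u y * K x y)) \<partial>lebesgue) < \<infinity>" .
qed

lemma set_integral_outside_ball_tendsto_0:
  fixes g :: "'a::euclidean_space \<Rightarrow> real"
  assumes g: "set_integrable lebesgue (- ball 0 r) g"
  shows "((\<lambda>R. LINT y:(- ball 0 R)|lebesgue. g y) \<longlongrightarrow> 0) at_top"
proof -
  \<comment> \<open>\<open>g\<close> is controlled only outside \<open>ball 0 r\<close>. Its cut-off
    \<open>h\<close> is integrable on the whole space, so measurability and the dominating function
    are available for every \<open>R\<close>; the integrals of \<open>g\<close> and \<open>h\<close>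
    agree once \<open>R \<ge> r\<close>.\<close>
  define h where "h y = indicator (- ball 0 r) y *\<^sub>R g y" for y
  have h: "integrable lebesgue h"
    using g unfolding set_integrable_def h_def .
  have "((\<lambda>R. LINT y|lebesgue. indicator (- ball 0 R) y *\<^sub>R h y)
      \<longlongrightarrow> (LINT (y::'a)|lebesgue. (0::real))) at_top"
  proof (rule integral_dominated_convergence_at_top)
    show "integrable lebesgue (\<lambda>y. norm (h y))"
      using h by simp
    show "AE y in lebesgue. ((\<lambda>R. indicator (- ball 0 R) y *\<^sub>R h y) \<longlongrightarrow> 0) at_top"
    proof (intro AE_I2 tendsto_eventually)
      fix y :: 'a
      show "\<forall>\<^sub>F R in at_top. indicator (- ball 0 R) y *\<^sub>R h y = 0"
        using eventually_gt_at_top[of "norm y"] by eventually_elim simp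
    qed
  next
    show "(\<lambda>y. indicator (- ball 0 R) y *\<^sub>R h y) \<in> borel_measurable lebesgue" for R
      using h by (intro borel_measurable_scaleR borel_measurable_indicator) auto
  qed (auto intro!: always_eventually simp: indicator_def)
  moreover have "\<forall>\<^sub>F R in at_top. (LINT y|lebesgue. indicator (- ball 0 R) y *\<^sub>R h y)
      = (LINT y:(- ball 0 R)|lebesgue. g y)"
    using eventually_ge_at_top[of r]
  proof eventually_elim
    case (elim R)
    show ?case
      unfolding set_lebesgue_integral_def h_def
      by (rule Bochner_Integration.integral_cong) (use elim in \<open>auto simp: indicator_def\<close>)
  qed
  ultimately show ?thesis
    by (simp add: tendsto_cong)
qed

text \<open>The function \<open>w\<close> vanishes on \<open>ball x d\<close>, so it leaves the
  value at \<open>x\<close> unchanged and never meets the singularity of the kernel: it contributes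
  an ordinary integral instead of a principal value. Keeping \<open>w\<close> general allows a far
  part to be removed or, with \<open>- w\<close>, restored.\<close>

lemma has_nonlocal_value_add_far:
  fixes K :: "real ^ 'n \<Rightarrow> real ^ 'n \<Rightarrow> real"
  assumes w: "set_integrable lebesgue S (\<lambda>y. w y * K x y)" and S: "S \<in> sets lebesgue"
    and "d > 0" and far: "S \<subseteq> - ball x d" and w0: "\<And>y. y \<notin> S \<Longrightarrow> w y = 0"
    and v: "has_nonlocal_value K v x l"
  shows "has_nonlocal_value K (\<lambda>y. v y - w y) x (l + (LINT y:S|lebesgue. w y * K x y))"
proof -
  have wx: "w x = 0"
    using far \<open>d > 0\<close> by (intro w0) auto
  have eq: "(v x - w x - (v y - w y)) * K x y = (v x - v y) * K x y + w y * K x y" for y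
    by (simp add: wx algebra_simps)
  \<comment> \<open>Since \<open>w\<close> is zero off \<open>S\<close>, integrability over
    \<open>S\<close> is integrability over the whole space, hence over each punctured
    domain.\<close>
  have int_w: "set_integrable lebesgue (- ball x \<epsilon>) (\<lambda>y. w y * K x y)" for \<epsilon>
  proof -
    have "set_integrable lebesgue UNIV (\<lambda>y. w y * K x y)"
      using w unfolding set_integrable_def
      by (rule Bochner_Integration.integrable_cong[THEN iffD1, rotated -1])
        (auto simp: indicator_def w0)
    then show ?thesis
      by (rule set_integrable_subset) auto
  qed
  have int_v: "set_integrable lebesgue (- ball x \<epsilon>) (\<lambda>y. (v x - v y) * K x y)" if "\<epsilon> > 0" for \<epsilon>
    using v that by (simp add: has_nonlocal_value_def)
  \<comment> \<open>For \<open>\<epsilon> < d\<close> the removed ball is disjoint from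
    \<open>S\<close>, so the contribution of \<open>w\<close> no longer depends on
    \<open>\<epsilon>\<close>.\<close>
  have "\<forall>\<^sub>F \<epsilon> in at_right 0.
      (LINT y:(- ball x \<epsilon>)|lebesgue. (v x - v y) * K x y) + (LINT y:S|lebesgue. w y * K x y)
      = (LINT y:(- ball x \<epsilon>)|lebesgue. (v x - w x - (v y - w y)) * K x y)"
    using eventually_at_right_less[of 0] eventually_at_right_real[OF \<open>d > 0\<close>]
  proof eventually_elim
    case (elim \<epsilon>)
    have "(LINT y:S|lebesgue. w y * K x y) = (LINT y:(- ball x \<epsilon>)|lebesgue. w y * K x y)"
      unfolding set_lebesgue_integral_def
      by (rule Bochner_Integration.integral_cong)
        (use elim far w0 in \<open>auto simp: indicator_def subset_iff\<close>)
    then show ?case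
      unfolding eq using elim by (simp add: set_integral_add int_v int_w)
  qed
  moreover have "((\<lambda>\<epsilon>. (LINT y:(- ball x \<epsilon>)|lebesgue. (v x - v y) * K x y)
      + (LINT y:S|lebesgue. w y * K x y)) \<longlongrightarrow> l + (LINT y:S|lebesgue. w y * K x y)) (at_right 0)"
    using v by (intro tendsto_intros) (simp add: has_nonlocal_value_def)
  ultimately have "((\<lambda>\<epsilon>. LINT y:(- ball x \<epsilon>)|lebesgue. (v x - w x - (v y - w y)) * K x y)
      \<longlongrightarrow> l + (LINT y:S|lebesgue. w y * K x y)) (at_right 0)"
    by (rule Lim_transform_eventually[rotated])
  moreover have "set_integrable lebesgue (- ball x \<epsilon>) (\<lambda>y. (v x - w x - (v y - w y)) * K x y)"
    if "\<epsilon> > 0" for \<epsilon>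
    unfolding eq using int_v[OF that] int_w by (rule set_integral_add)
  ultimately show ?thesis
    by (simp add: has_nonlocal_value_def)
qed

text \<open>The tail enters with a plus sign because truncation drops \<open>- u y\<close> from
  \<open>u x - u y\<close>. One direction subtracts the far part of \<open>u\<close>, the other adds
  it back, which cancels the tail.\<close>

lemma has_nonlocal_value_truncate_iff:
  fixes K :: "real ^ 'n \<Rightarrow> real ^ 'n \<Rightarrow> real"
  assumes tail: "set_integrable lebesgue (- ball 0 R) (\<lambda>y. u y * K x y)" and x: "norm x < R"
  shows "has_nonlocal_value K (\<lambda>y. indicator (ball 0 R) y * u y) x
           (l + (LINT y:(- ball 0 R)|lebesgue. u y * K x y)) \<longleftrightarrow> has_nonlocal_value K u x l"
proof -
  define w where "w y = indicator (- ball 0 R) y * u y" for y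
  define T where "T = (LINT y:(- ball 0 R)|lebesgue. u y * K x y)"
  have w_tail: "set_integrable lebesgue (- ball 0 R) (\<lambda>y. w y * K x y)"
  proof -
    have "(\<lambda>y. indicator (- ball 0 R) y *\<^sub>R (w y * K x y))
        = (\<lambda>y. indicator (- ball 0 R) y *\<^sub>R (u y * K x y))"
      by (auto simp: w_def indicator_def)
    then show ?thesis
      using tail by (simp only: set_integrable_def)
  qed
  then have w_tail': "set_integrable lebesgue (- ball 0 R) (\<lambda>y. - w y * K x y)"
    by (simp add: set_integrable_def)
  have T: "(LINT y:(- ball 0 R)|lebesgue. w y * K x y) = T"
    unfolding T_def set_lebesgue_integral_def
    by (rule Bochner_Integration.integral_cong) (auto simp: w_def indicator_def)
  then have T': "(LINT y:(- ball 0 R)|lebesgue. - w y * K x y) = - T"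
    by (simp add: set_lebesgue_integral_def)
  \<comment> \<open>By the triangle inequality, a ball of radius \<open>R - norm x\<close> around
    \<open>x\<close> stays inside \<open>ball 0 R\<close>.\<close>
  have far: "- ball 0 R \<subseteq> - ball x (R - norm x)"
  proof (rule subsetI)
    fix y :: "real ^ 'n" assume "y \<in> - ball 0 R"
    then show "y \<in> - ball x (R - norm x)"
      using norm_triangle_ineq2[of y x] by (auto simp: dist_norm norm_minus_commute)
  qed
  have d: "R - norm x > 0" and meas: "- ball 0 R \<in> sets lebesgue"
    using x by auto
  have w0: "w y = 0" if "y \<notin> - ball 0 R" for y
    using that by (simp add: w_def)
  have trunc: "(\<lambda>y. u y - w y) = (\<lambda>y. indicator (ball 0 R) y * u y)"
    and untrunc: "(\<lambda>y. indicator (ball 0 R) y * u y - - w y) = u"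
    by (auto simp: w_def indicator_def)
  show ?thesis
    unfolding T_def[symmetric]
  proof
    assume "has_nonlocal_value K u x l"
    from has_nonlocal_value_add_far[where w = w, OF w_tail meas d far w0 this]
    show "has_nonlocal_value K (\<lambda>y. indicator (ball 0 R) y * u y) x (l + T)"
      unfolding trunc T .
  next
    assume "has_nonlocal_value K (\<lambda>y. indicator (ball 0 R) y * u y) x (l + T)"
    from has_nonlocal_value_add_far[where w = "\<lambda>y. - w y", OF w_tail' meas d far _ this] w0
    show "has_nonlocal_value K u x l"
      unfolding untrunc T' by simp
  qed
qed

theorem corollary2p13:
  fixes K :: "real ^ 'n \<Rightarrow> real ^ 'n \<Rightarrow> real"
    and u f :: "real ^ 'n \<Rightarrow> real"
    and \<theta> :: real
  assumes "0 \<le> \<theta>" and "\<theta> \<le> 2"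
    and "K \<in> kernel_class \<theta>"
    and "u \<in> function_kernel_class \<theta> K"
    and "continuous_on (ball 0 1) f" and "bounded (f ` ball 0 1)"
  shows "nonlocal_eq K u f \<longleftrightarrow> nonlocal_eq0 K u f"
proof -
  define T where "T R x = (LINT y:(- ball 0 R)|lebesgue. u y * K x y)" for R x
  have tail: "set_integrable lebesgue (- ball 0 3) (\<lambda>y. u y * K x y)" if "x \<in> ball 0 1" for x
    using assms(3,4) that by (rule set_integrable_tail)
  have T_lim: "((\<lambda>R. T R x) \<longlongrightarrow> 0) at_top" if "x \<in> ball 0 1" for x
    unfolding T_def using tail[OF that] by (rule set_integral_outside_ball_tendsto_0)
  have trunc: "has_nonlocal_value K (\<lambda>y. indicator (ball 0 R) y * u y) x (l + T R x)
      \<longleftrightarrow> has_nonlocal_value K u x l" if "x \<in> ball 0 1" "R > 3" for R x l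
    unfolding T_def
  proof (rule has_nonlocal_value_truncate_iff)
    show "set_integrable lebesgue (- ball 0 R) (\<lambda>y. u y * K x y)"
      using tail[OF that(1)] by (rule set_integrable_subset) (use that in auto)
  qed (use that in auto)
  show ?thesis
  proof
    assume "nonlocal_eq K u f"
    \<comment> \<open>By \<open>trunc\<close> the truncated values must be
      \<open>f x + T R x\<close>, so this family is the witness.\<close>
    then have "\<forall>R>3. nonlocal_eq K (\<lambda>y. indicator (ball 0 R) y * u y) (\<lambda>x. f x + T R x)"
      by (simp add: nonlocal_eq_def trunc)
    moreover have "\<forall>x \<in> ball 0 1. ((\<lambda>R. f x + T R x) \<longlongrightarrow> f x) at_top"
      using T_lim by (auto intro!: tendsto_eq_intros)
    ultimately show "nonlocal_eq0 K u f"
      unfolding nonlocal_eq0_def by (intro exI[of _ "\<lambda>R x. f x + T R x"]) simp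
  next
    assume "nonlocal_eq0 K u f"
    then obtain F where F: "\<forall>R>3. nonlocal_eq K (\<lambda>y. indicator (ball 0 R) y * u y) (F R)"
      and F_lim: "\<forall>x \<in> ball 0 1. ((\<lambda>R. F R x) \<longlongrightarrow> f x) at_top"
      unfolding nonlocal_eq0_def by (elim exE conjE)
    show "nonlocal_eq K u f"
      unfolding nonlocal_eq_def
    proof
      fix x :: "real ^ 'n" assume x: "x \<in> ball 0 1"
      \<comment> \<open>The choice \<open>l = F R x - T R x\<close> turns \<open>l + T R x\<close>
        into \<open>F R x\<close>, so a value for a single truncation already gives one for
        \<open>u\<close> itself.\<close>
      have val: "has_nonlocal_value K u x (F R x - T R x)" if "R > 3" for R
        using F[rule_format, OF that] trunc[OF x that, of "F R x - T R x"] x by (simp add: nonlocal_eq_def)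
      \<comment> \<open>\<open>Au(x)\<close> does not depend on \<open>R\<close>, so neither does \<open>F R x - T R x\<close>.\<close>
      have "F R x - T R x = F 4 x - T 4 x" if "R > 3" for R
        using val[OF that] val[of 4] unfolding has_nonlocal_value_def
        by (intro tendsto_unique[OF trivial_limit_at_right_real]) auto
      then have "\<forall>\<^sub>F R in at_top. F R x - T R x = F 4 x - T 4 x"
        by (rule eventually_mono[OF eventually_gt_at_top[of 3]])
      then have "((\<lambda>R. F R x - T R x) \<longlongrightarrow> F 4 x - T 4 x) at_top"
        by (rule tendsto_eventually)
      \<comment> \<open>The vanishing tail identifies the constant as \<open>f x\<close>; the radius
        \<open>4\<close> stands for any fixed one above 3.\<close>
      moreover have "((\<lambda>R. F R x - T R x) \<longlongrightarrow> f x) at_top"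
        using tendsto_diff[OF F_lim[rule_format, OF x] T_lim[OF x]] by simp
      ultimately have "F 4 x - T 4 x = f x"
        by (rule tendsto_unique[OF trivial_limit_at_top_linorder])
      then show "has_nonlocal_value K u x (f x)"
        using val[of 4] by simp
    qed
  qed
qed

end
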